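(* Let $b$ be a graph over $(X,m)$. For all $p\in(1,\infty)$, $$\frac{2^{p-1}}{p^{p}}\,\bigl(h^{(0)}_{p}\bigr)^{p}\leq \lambda^{(0)}_{p}.$$
   Context: Setting: $X$ is a nonempty countable (finite or infinite) set, $C(X)$ is the space of real-valued functions on $X$ and $C_c(X)$ the subspace of finitely supported functions. A graph $b$ over $(X,m)$ consists of a symmetric function $b:X\times X\to[0,\infty)$ with $b(x,x)=0$ and $\sum_{y\in X}b(x,y)<\infty$ for all $x\in X$, and a function $m:X\to(0,\infty)$, extended to a measure on subsets by $m(W)=\sum_{x\in W}m(x)$. No connectedness or boundedness assumption is made. $\|f\|_{m,p}=\bigl(\sum_{x\in X}|f(x)|^p m(x)\bigr)^{1/p}$. Energy: $\mathcal{E}_p(f)=\frac12\sum_{x,y\in X}b(x,y)|f(x)-f(y)|^p\in[0,\infty]$ for $f\in C(X)$, and $$\lambda^{(0)}_p=\inf_{0\neq\varphi\in C_c(X)}\frac{\mathcal{E}_p(\varphi)}{\|\varphi\|_{m,p}^p}.$$ For $p\in(1,\infty)$, $R_p(b,m)$ is the set of all symmetric functions $d:X\times X\to[0,\infty)$ such that $\sum_{y\in X}b(x,y)d(x,y)^{p/(p-1)}\le m(x)$ for all $x\in X$. For $W\subseteq X$, $\partial W=W\times(X\setminus W)$, and for $d:X\times X\to[0,\infty)$, $|\partial W|_{bd}=\sum_{(x,y)\in\partial W}b(x,y)d(x,y)$. The isoperimetric constants are $$h^{(0)}(d)=\inf_{\emptyset\ne W\subseteq X\text{ finite}}\frac{|\partial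 W|_{bd}}{m(W)},\qquad h^{(0)}_p=\sup_{d\in R_p(b,m)}h^{(0)}(d).$$ *)

theory Defs
  imports "HOL-Analysis.Analysis"
begin

text \<open>
  The vertex set is the universe of a type of class \<open>countable\<close> (nonempty, finite or
  infinite). Quantities that may a priori be infinite live in \<^typ>\<open>ennreal\<close>, where every
  family is summable and every supremum and infimum exists.
\<close>

locale weighted_graph =
  fixes b :: "'a::countable \<Rightarrow> 'a \<Rightarrow> real" and m :: "'a \<Rightarrow> real"
  assumes b_nonneg: "0 \<le> b x y"
    and b_sym: "b x y = b y x"
    and b_diag: "b x x = 0"
    and b_summable: "b x summable_on UNIV"
    and m_pos: "0 < m x"

text \<open>Real powers on $[0,\infty]$, meant for exponents \<open>p > 0\<close>.\<close>

definition epowr :: "ennreal \<Rightarrow> real \<Rightarrow> ennreal" where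
  "epowr x p = (if x = \<infinity> then \<infinity> else ennreal (enn2real x powr p))"

definition vmeasure :: "('a \<Rightarrow> real) \<Rightarrow> 'a set \<Rightarrow> ennreal" where
  "vmeasure m W = (\<Sum>\<^sub>\<infinity>x\<in>W. ennreal (m x))"

definition finitely_supported :: "('a \<Rightarrow> real) set" where
  "finitely_supported = {f. finite {x. f x \<noteq> 0}}"

definition pnorm :: "('a \<Rightarrow> real) \<Rightarrow> real \<Rightarrow> ('a \<Rightarrow> real) \<Rightarrow> ennreal" where
  "pnorm m p f = epowr (\<Sum>\<^sub>\<infinity>x\<in>UNIV. ennreal (\<bar>f x\<bar> powr p * m x)) (1 / p)"

definition energy :: "('a \<Rightarrow> 'a \<Rightarrow> real) \<Rightarrow> real \<Rightarrow> ('a \<Rightarrow> real) \<Rightarrow> ennreal" where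
  "energy b p f =
     ennreal (1 / 2) * (\<Sum>\<^sub>\<infinity>(x, y)\<in>UNIV. ennreal (b x y * \<bar>f x - f y\<bar> powr p))"

definition lambda0 :: "('a \<Rightarrow> 'a \<Rightarrow> real) \<Rightarrow> ('a \<Rightarrow> real) \<Rightarrow> real \<Rightarrow> ennreal" where
  "lambda0 b m p =
     (INF \<phi>\<in>finitely_supported - {\<lambda>_. 0}. energy b p \<phi> / epowr (pnorm m p \<phi>) p)"

definition admissible :: "('a \<Rightarrow> 'a \<Rightarrow> real) \<Rightarrow> ('a \<Rightarrow> real) \<Rightarrow> real \<Rightarrow> ('a \<Rightarrow> 'a \<Rightarrow> real) set" where
  "admissible b m p =
     {d. (\<forall>x y. 0 \<le> d x y) \<and> (\<forall>x y. d x y = d y x) \<and>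
         (\<forall>x. (\<Sum>\<^sub>\<infinity>y\<in>UNIV. ennreal (b x y * d x y powr (p / (p - 1)))) \<le> ennreal (m x))}"

definition edge_boundary :: "'a set \<Rightarrow> ('a \<times> 'a) set" where
  "edge_boundary W = W \<times> (UNIV - W)"

definition boundary_area ::
    "('a \<Rightarrow> 'a \<Rightarrow> real) \<Rightarrow> ('a \<Rightarrow> 'a \<Rightarrow> real) \<Rightarrow> 'a set \<Rightarrow> ennreal" where
  "boundary_area b d W = (\<Sum>\<^sub>\<infinity>(x, y)\<in>edge_boundary W. ennreal (b x y * d x y))"

definition isoperimetric ::
    "('a \<Rightarrow> 'a \<Rightarrow> real) \<Rightarrow> ('a \<Rightarrow> real) \<Rightarrow> ('a \<Rightarrow> 'a \<Rightarrow> real) \<Rightarrow> ennreal" where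
  "isoperimetric b m d =
     (INF W\<in>{W. finite W \<and> W \<noteq> {}}. boundary_area b d W / vmeasure m W)"

definition isoperimetric_const ::
    "('a \<Rightarrow> 'a \<Rightarrow> real) \<Rightarrow> ('a \<Rightarrow> real) \<Rightarrow> real \<Rightarrow> ennreal" where
  "isoperimetric_const b m p = (SUP d\<in>admissible b m p. isoperimetric b m d)"

end

theory Submission
  imports Defs
begin

text \<open>
  Fix \<open>d \<in> R\<^sub>p(b,m)\<close>, \<open>h \<le> h\<^sup>(\<^sup>0\<^sup>)(d)\<close> and \<open>\<phi> \<in> C\<^sub>c(X)\<close>, and
  put \<open>N = \<parallel>\<phi>\<parallel>\<^sup>p\<close>. Applying the isoperimetric inequality to the
  superlevel sets of \<open>|\<phi>|\<^sup>p\<close> and integrating over the levels (co-area formula) gives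
  \<open>2 h N \<le> \<Sum> b(x,y) d(x,y) | |\<phi>(x)|\<^sup>p - |\<phi>(y)|\<^sup>p |\<close>. Hermite--Hadamard and Jensen bound
  \<open>| |u|\<^sup>p - |v|\<^sup>p |\<close> by \<open>p |u - v| ((|u|\<^sup>p + |v|\<^sup>p) / 2)\<^bsup>(p - 1) / p\<^esup>\<close>. In place of Hoelder's
  inequality for the sum, Young's inequality with a parameter \<open>s\<close> is used in each term; with the
  defining property of \<open>R\<^sub>p(b,m)\<close> this yields
  \<open>2 h N \<le> 2 s\<^bsup>1 - p\<^esup> E\<^sub>p(\<phi>) + (p - 1) s N\<close>, and \<open>s = 2 h / p\<close> gives the theorem.
\<close>

section \<open>Inequalities for real powers\<close>

lemma Young_powr:
  fixes a t p :: real
  assumes "1 < p" "0 \<le> a" "0 \<le> t"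
  shows "p * (a * t powr (p - 1)) \<le> a powr p + (p - 1) * t powr p"
proof -
  have "a * t powr (p - 1) \<le> a powr p / p + (t powr (p - 1)) powr (p / (p - 1)) / (p / (p - 1))"
    using assms by (intro Youngs_inequality) (auto simp: field_simps)
  also have "(t powr (p - 1)) powr (p / (p - 1)) = t powr p"
    using assms by (simp add: powr_powr)
  finally show ?thesis
    using assms by (simp add: field_simps)
qed

text \<open>The supporting line of the convex p-th power at \<open>t\<close>: Young's inequality,
  rearranged with t * t^(p-1) = t^p.\<close>

lemma powr_tangent_le:
  fixes a t p :: real
  assumes "1 < p" "0 \<le> a" "0 < t"
  shows "t powr p + p * t powr (p - 1) * (a - t) \<le> a powr p"
proof -
  have "t * t powr (p - 1) = t powr p"
    using assms by (simp add: powr_mult_base)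
  then show ?thesis
    using Young_powr[of p a t] assms by (simp add: algebra_simps)
qed

lemma has_real_derivative_powr_primitive:
  fixes t p :: real
  assumes "p \<noteq> - 1" "0 < t"
  shows "((\<lambda>t. t powr (p + 1) / (p + 1)) has_real_derivative t powr p) (at t)"
  using DERIV_cdivide[OF has_real_derivative_powr[OF assms(2), of "p + 1"], of "p + 1"] assms
  by (simp add: add_eq_0_iff2)

text \<open>Trapezoidal bound for the integral of t^p over [v, u], with the integral written through
  its primitive. The gap vanishes at u = v, and its derivative in the upper end point t is half the
  gap in \<open>powr_tangent_le\<close> for the tangent at t evaluated at \<open>v\<close>.\<close>

lemma powr_Hermite_Hadamard:
  fixes u v p :: real
  assumes "1 < p" "0 \<le> v" "v \<le> u"
  shows "(u powr (p + 1) - v powr (p + 1)) / (p + 1) \<le> (u - v) * ((u powr p + v powr p) / 2)"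
proof -
  let ?H = "\<lambda>t. (t - v) * ((t powr p + v powr p) / 2) - t powr (p + 1) / (p + 1)"
  have "?H v \<le> ?H u"
  proof (rule DERIV_nonneg_imp_increasing_open[OF assms(3)])
    fix t assume t: "v < t" "t < u"
    have "(?H has_real_derivative
        (t powr p + v powr p) / 2 + (t - v) * (p * t powr (p - 1) / 2) - t powr p) (at t)"
      using t assms
      by (auto intro!: derivative_eq_intros has_real_derivative_powr_primitive)
    moreover have "0 \<le> (t powr p + v powr p) / 2 + (t - v) * (p * t powr (p - 1) / 2) - t powr p"
      using powr_tangent_le[of p v t] t assms by (simp add: field_simps)
    ultimately show "\<exists>y. DERIV ?H t :> y \<and> y \<ge> 0" by blast
  qed (use assms in \<open>auto intro!: continuous_on_add continuous_on_diff continuous_on_mult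
      continuous_on_divide continuous_on_const continuous_on_id continuous_on_powr'\<close>)
  then show ?thesis
    by (simp only: diff_self mult_zero_left diff_divide_distrib)
qed

text \<open>With \<open>r\<close> the p-mean of \<open>u\<close> and \<open>v\<close>, Young's
  inequality p r t^(p-1) \<le> r^p + (p-1) t^p is integrated over t in [v, u]. Hermite-Hadamard
  bounds the integral of t^p by (u - v) r^p, and division by \<open>r\<close> finishes.\<close>

lemma powr_diff_le_mean:
  fixes u v p :: real
  assumes "1 < p" "0 \<le> v" "v \<le> u"
  defines "r \<equiv> ((u powr p + v powr p) / 2) powr (1 / p)"
  shows "u powr p - v powr p \<le> p * ((u - v) * r powr (p - 1))"
proof (cases "u = 0")
  case False
  then have "0 < u" using assms by simp
  then have pos: "0 < u powr p + v powr p"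
    by (simp add: add_pos_nonneg)
  then have r: "0 < r" "r powr p = (u powr p + v powr p) / 2"
    using assms by (simp_all add: r_def powr_powr)
  let ?G = "\<lambda>t. r powr p * t + (p - 1) * (t powr (p + 1) / (p + 1)) - r * t powr p"
  have "?G v \<le> ?G u"
  proof (rule DERIV_nonneg_imp_increasing_open[OF assms(3)])
    fix t assume t: "v < t" "t < u"
    have "(?G has_real_derivative
        r powr p + (p - 1) * t powr p - r * (p * t powr (p - 1))) (at t)"
      using t assms(1,2)
      by (auto intro!: derivative_eq_intros has_real_derivative_powr_primitive)
    moreover have "0 \<le> r powr p + (p - 1) * t powr p - r * (p * t powr (p - 1))"
      using Young_powr[of p r t] t assms(1,2) r(1) by (simp add: algebra_simps)
    ultimately show "\<exists>y. DERIV ?G t :> y \<and> y \<ge> 0" by blast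
  qed (use assms(1-3) in \<open>auto intro!: continuous_on_add continuous_on_diff continuous_on_mult
      continuous_on_divide continuous_on_const continuous_on_id continuous_on_powr'\<close>)
  then have "r * (u powr p - v powr p)
      \<le> r powr p * (u - v) + (p - 1) * ((u powr (p + 1) - v powr (p + 1)) / (p + 1))"
    by (simp add: algebra_simps diff_divide_distrib)
  also have "\<dots> \<le> r powr p * (u - v) + (p - 1) * ((u - v) * r powr p)"
    unfolding r(2) using powr_Hermite_Hadamard[OF assms(1-3)] assms(1)
    by (intro add_left_mono mult_left_mono) auto
  also have "\<dots> = p * ((u - v) * r powr p)"
    by (simp add: algebra_simps)
  also have "r powr p = r * r powr (p - 1)"
    using r by (simp add: powr_mult_base)
  finally have "r * (u powr p - v powr p) \<le> r * (p * ((u - v) * r powr (p - 1)))"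
    by (simp add: algebra_simps)
  then show ?thesis using r by simp
qed (use assms in auto)

text \<open>Symmetry in \<open>u\<close> and \<open>v\<close> allows |v| \<le> |u|; then
  \<open>powr_diff_le_mean\<close> and the reverse triangle inequality leave a product to which
  Young's inequality applies.\<close>

lemma weighted_powr_diff_le:
  fixes u v d s p :: real
  assumes "1 < p" "0 \<le> d" "0 < s"
  shows "d * \<bar>\<bar>u\<bar> powr p - \<bar>v\<bar> powr p\<bar>
    \<le> s powr (1 - p) * \<bar>u - v\<bar> powr p
      + (p - 1) * s * (d powr (p / (p - 1)) * ((\<bar>u\<bar> powr p + \<bar>v\<bar> powr p) / 2))"
proof (induction "\<bar>v\<bar>" "\<bar>u\<bar>" arbitrary: u v rule: linorder_wlog)
  case le
  define r where "r = ((\<bar>u\<bar> powr p + \<bar>v\<bar> powr p) / 2) powr (1 / p)"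
  have rp: "r powr p = (\<bar>u\<bar> powr p + \<bar>v\<bar> powr p) / 2"
    using assms by (simp add: r_def powr_powr)
  have r: "0 \<le> r" by (simp add: r_def)
  \<comment> \<open>The powers of \<open>s\<close> cancel in A * B^(p-1) = |u - v| d r^(p-1), while
    A^p and B^p carry the factors s^(1-p) and s.\<close>
  define A where "A = s powr (- (p - 1) / p) * \<bar>u - v\<bar>"
  define B where "B = (s powr (1 / p) * d powr (1 / (p - 1))) * r"
  have mono: "\<bar>v\<bar> powr p \<le> \<bar>u\<bar> powr p"
    using le assms by (intro powr_mono2) auto
  have "d * \<bar>\<bar>u\<bar> powr p - \<bar>v\<bar> powr p\<bar> = d * (\<bar>u\<bar> powr p - \<bar>v\<bar> powr p)"
    using mono by simp
  also have "\<dots> \<le> d * (p * ((\<bar>u\<bar> - \<bar>v\<bar>) * r powr (p - 1)))"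
    using powr_diff_le_mean[OF assms(1) abs_ge_zero le] assms
    by (intro mult_left_mono) (simp_all add: r_def)
  also have "\<dots> \<le> d * (p * (\<bar>u - v\<bar> * r powr (p - 1)))"
    using assms by (intro mult_left_mono mult_right_mono) auto
  also have "\<dots> = p * (A * B powr (p - 1))"
  proof -
    have "B powr (p - 1) = s powr ((p - 1) / p) * d * r powr (p - 1)"
      using assms r by (simp add: B_def powr_mult powr_powr)
    moreover have "s powr (- (p - 1) / p) * s powr ((p - 1) / p) = 1"
      using assms by (simp flip: powr_add add: diff_divide_distrib)
    ultimately show ?thesis
      unfolding A_def by (metis (no_types, opaque_lifting) mult.assoc mult.commute mult_1)
  qed
  also have "\<dots> \<le> A powr p + (p - 1) * B powr p"
    using assms r by (intro Young_powr) (auto simp: A_def B_def)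
  also have "A powr p = s powr (1 - p) * \<bar>u - v\<bar> powr p"
    using assms by (simp add: A_def powr_mult powr_powr)
  also have "B powr p = s * (d powr (p / (p - 1)) * r powr p)"
    using assms r by (simp add: B_def powr_mult powr_powr)
  finally show ?case by (simp add: rp mult.assoc)
next
  case (sym u v)
  then show ?case by (simp add: abs_minus_commute add.commute)
qed

section \<open>Countable sums as integrals for counting measure\<close>

text \<open>Gives the sums in the definitions access to Tonelli's theorem. An infinite
  \<open>A\<close> is enumerated by the naturals, which turns both sides into the same
  series.\<close>

lemma infsum_ennreal_eq_nn_integral:
  fixes f :: "'a \<Rightarrow> ennreal"
  assumes "countable A"
  shows "infsum f A = (\<integral>\<^sup>+x. f x \<partial>count_space A)"
proof (cases "finite A")
  case True
  then show ?thesis by (simp add: nn_integral_count_space_finite)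
next
  case False
  then have bij: "bij_betw (from_nat_into A) UNIV A"
    using assms by (rule bij_betw_from_nat_into[rotated])
  have "infsum f A = infsum (\<lambda>n. f (from_nat_into A n)) UNIV"
    using infsum_reindex_bij_betw[OF bij, of f] by simp
  also have "\<dots> = (\<Sum>n. f (from_nat_into A n))"
    by (intro sums_unique has_sum_imp_sums has_sum_infsum nonneg_summable_on_complete) simp
  also have "\<dots> = (\<integral>\<^sup>+x. f x \<partial>count_space A)"
    using nn_integral_bij_count_space[OF bij, of f] by (simp add: nn_integral_count_space_nat)
  finally show ?thesis .
qed

text \<open>Tonelli: on countable types the product of the counting measures is the counting measure
  of the product.\<close>

lemma nn_integral_count_space_pair:
  fixes f :: "'a::countable \<Rightarrow> 'b::countable \<Rightarrow> ennreal"
  shows "(\<integral>\<^sup>+z. f (fst z) (snd z) \<partial>count_space UNIV)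
    = (\<integral>\<^sup>+x. \<integral>\<^sup>+y. f x y \<partial>count_space UNIV \<partial>count_space UNIV)"
proof -
  have eq: "count_space (UNIV :: ('a \<times> 'b) set) = count_space UNIV \<Otimes>\<^sub>M count_space UNIV"
    by (subst pair_measure_countable) auto
  interpret sigma_finite_measure "count_space (UNIV :: 'b set)"
    by (rule sigma_finite_measure_count_space)
  show ?thesis
    unfolding eq by (subst nn_integral_fst[symmetric]) (auto simp flip: eq)
qed

lemma nn_integral_count_space_swap:
  fixes f :: "'a \<times> 'a \<Rightarrow> ennreal"
  shows "(\<integral>\<^sup>+z. f (prod.swap z) \<partial>count_space UNIV) = (\<integral>\<^sup>+z. f z \<partial>count_space UNIV)"
  by (rule nn_integral_bij_count_space) simp

section \<open>Co-area formula\<close>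

text \<open>For \<open>b\<close> below \<open>a\<close> the interval is empty and
  \<open>ennreal\<close> truncates the negative length to 0, so the formula covers both orientations
  of an edge.\<close>

lemma emeasure_lborel_Ico_eq: "emeasure lborel {a..<b::real} = ennreal (b - a)"
  by (cases "a \<le> b") (auto simp: ennreal_neg)

text \<open>
  The coercion \<open>ennreal\<close> sends negative reals to 0, so \<open>ennreal (g x - g y)\<close> below is a
  positive part and each edge contributes in one orientation only.
\<close>

lemma isoperimetric_coarea:
  fixes b d :: "'a::countable \<Rightarrow> 'a \<Rightarrow> real" and g :: "'a \<Rightarrow> real"
  assumes iso: "\<And>W. finite W \<Longrightarrow> W \<noteq> {} \<Longrightarrow> H * vmeasure m W \<le> boundary_area b d W"
    and g_nonneg: "\<And>x. 0 \<le> g x" and g_fin: "finite {x. g x \<noteq> 0}"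
  shows "H * (\<integral>\<^sup>+x. ennreal (m x) * ennreal (g x) \<partial>count_space UNIV)
    \<le> (\<integral>\<^sup>+z. ennreal (b (fst z) (snd z) * d (fst z) (snd z)) * ennreal (g (fst z) - g (snd z))
          \<partial>count_space UNIV)"
proof -
  define w where "w z = ennreal (b (fst z) (snd z) * d (fst z) (snd z))" for z
  \<comment> \<open>For t \<ge> 0, \<open>V t\<close> and \<open>A t\<close> are the measure and the
    boundary area of the superlevel set {x. t < g x}: g y \<le> t < g x says that the pair (x, y)
    leaves this set.\<close>
  define V where "V t = (\<integral>\<^sup>+x. ennreal (m x) * indicator {0..<g x} t \<partial>count_space UNIV)"
    for t :: real
  define A where "A t = (\<integral>\<^sup>+z. w z * indicator {g (snd z)..<g (fst z)} t \<partial>count_space UNIV)"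
    for t :: real
  have level: "H * V t \<le> A t" for t
  proof (cases "0 \<le> t \<and> {x. t < g x} \<noteq> {}")
    case True
    define W where "W = {x. t < g x}"
    have "finite W"
      using True by (intro finite_subset[OF _ g_fin]) (auto simp: W_def)
    have "V t = (\<integral>\<^sup>+x. ennreal (m x) * indicator W x \<partial>count_space UNIV)"
      unfolding V_def using True by (intro nn_integral_cong) (auto simp: W_def indicator_def)
    also have "\<dots> = vmeasure m W"
      by (simp add: vmeasure_def infsum_ennreal_eq_nn_integral nn_integral_count_space_indicator)
    finally have V: "V t = vmeasure m W" .
    have "A t = (\<integral>\<^sup>+z. w z * indicator (edge_boundary W) z \<partial>count_space UNIV)"
      unfolding A_def
      by (intro nn_integral_cong) (auto simp: W_def edge_boundary_def indicator_def)
    also have "\<dots> = boundary_area b d W"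
      by (simp add: boundary_area_def infsum_ennreal_eq_nn_integral w_def case_prod_beta
          nn_integral_count_space_indicator)
    finally show ?thesis
      using iso[OF \<open>finite W\<close>] True by (simp add: V W_def)
  next
    \<comment> \<open>Either t < 0 lies outside every [0, g x), or no vertex lies above level
      t.\<close>
    case False
    then have "V t = (\<integral>\<^sup>+x. 0 \<partial>count_space (UNIV :: 'a set))"
      unfolding V_def by (intro nn_integral_cong) (auto simp: indicator_def not_less)
    then show ?thesis by simp
  qed
  \<comment> \<open>Layer cake: g x is the length of [0, g x), and Tonelli exchanges vertices and
    levels; the edge side is treated in the same way backwards.\<close>
  have "H * (\<integral>\<^sup>+x. ennreal (m x) * ennreal (g x) \<partial>count_space UNIV)
      = (\<integral>\<^sup>+x. \<integral>\<^sup>+t. H * (ennreal (m x) * indicator {0..<g x} t) \<partial>lborel \<partial>count_space UNIV)"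
    by (simp add: nn_integral_cmult emeasure_lborel_Ico_eq del: emeasure_lborel_Ico)
  also have "\<dots> = (\<integral>\<^sup>+t. H * V t \<partial>lborel)"
    unfolding V_def
    by (subst nn_integral_count_space_nn_integral[symmetric]) (auto simp: nn_integral_cmult)
  also have "\<dots> \<le> (\<integral>\<^sup>+t. A t \<partial>lborel)"
    by (intro nn_integral_mono level)
  also have "\<dots> = (\<integral>\<^sup>+z. \<integral>\<^sup>+t. w z * indicator {g (snd z)..<g (fst z)} t \<partial>lborel
      \<partial>count_space UNIV)"
    unfolding A_def by (subst nn_integral_count_space_nn_integral) auto
  also have "\<dots> = (\<integral>\<^sup>+z. w z * ennreal (g (fst z) - g (snd z)) \<partial>count_space UNIV)"
    by (simp add: nn_integral_cmult emeasure_lborel_Ico_eq del: emeasure_lborel_Ico)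
  finally show ?thesis by (simp add: w_def)
qed

section \<open>Energy estimate for a fixed admissible weight\<close>

lemma (in weighted_graph) vmeasure_finite:
  assumes "finite W"
  shows "vmeasure m W = ennreal (sum m W)"
  using assms m_pos by (simp add: vmeasure_def less_imp_le)

lemma (in weighted_graph) isoperimetric_le_boundary_area:
  assumes "H \<le> isoperimetric b m d" "finite W" "W \<noteq> {}"
  shows "H * vmeasure m W \<le> boundary_area b d W"
proof -
  \<comment> \<open>The measure of \<open>W\<close> is positive and finite, so the division in
    \<open>ennreal\<close> can be undone.\<close>
  have pos: "0 < sum m W" using assms m_pos by (intro sum_pos) auto
  have "H \<le> boundary_area b d W / vmeasure m W"
    using assms unfolding isoperimetric_def by (auto intro: order_trans INF_lower)
  then have "H * vmeasure m W \<le> boundary_area b d W / vmeasure m W * vmeasure m W"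
    by (rule mult_right_mono) simp
  also have "\<dots> = boundary_area b d W"
    using pos unfolding vmeasure_finite[OF assms(2)]
    by (subst ennreal_divide_times) simp
  finally show ?thesis .
qed

lemma ennreal_add_mult:
  assumes "0 \<le> a" "0 \<le> b" "0 \<le> c" "0 \<le> d"
  shows "ennreal (a * b + c * d) = ennreal a * ennreal b + ennreal c * ennreal d"
  using assms by (simp add: ennreal_mult)

text \<open>By symmetry of \<open>b\<close> and \<open>d\<close> both halves of the mean contribute
  equally. What remains is the sum over x of \<open>a x\<close> times the sum over y of b
  d^(p/(p-1)), and admissibility bounds the inner sum by \<open>m x\<close>.\<close>

lemma admissible_weighted_sum_le:
  fixes b d :: "'a::countable \<Rightarrow> 'a \<Rightarrow> real" and a :: "'a \<Rightarrow> real"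
  assumes "d \<in> admissible b m p" "\<And>x y. 0 \<le> b x y" "\<And>x y. b x y = b y x" "\<And>x. 0 \<le> a x"
  shows "(\<integral>\<^sup>+z. ennreal (b (fst z) (snd z) * (d (fst z) (snd z) powr (p / (p - 1))
              * ((a (fst z) + a (snd z)) / 2))) \<partial>count_space UNIV)
    \<le> (\<integral>\<^sup>+x. ennreal (a x * m x) \<partial>count_space UNIV)"
proof -
  define D where "D x y = b x y * d x y powr (p / (p - 1))" for x y
  have D_nonneg: "0 \<le> D x y" for x y using assms by (simp add: D_def)
  have D_sym: "D x y = D y x" for x y
    using assms by (simp add: D_def admissible_def)
  let ?F = "\<lambda>z. ennreal (a (fst z) / 2) * ennreal (D (fst z) (snd z))"
  have "(\<integral>\<^sup>+z. ennreal (b (fst z) (snd z) * (d (fst z) (snd z) powr (p / (p - 1))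
              * ((a (fst z) + a (snd z)) / 2))) \<partial>count_space UNIV)
      = (\<integral>\<^sup>+z. ?F z + ?F (prod.swap z) \<partial>count_space UNIV)"
  proof (intro nn_integral_cong)
    fix z :: "'a \<times> 'a"
    have "b (fst z) (snd z) * (d (fst z) (snd z) powr (p / (p - 1)) * ((a (fst z) + a (snd z)) / 2))
      = a (fst z) / 2 * D (fst z) (snd z) + a (snd z) / 2 * D (snd z) (fst z)"
      unfolding D_sym[of "snd z"] by (simp add: D_def field_simps)
    then show "ennreal (b (fst z) (snd z) * (d (fst z) (snd z) powr (p / (p - 1))
        * ((a (fst z) + a (snd z)) / 2))) = ?F z + ?F (prod.swap z)"
      using ennreal_add_mult[of "a (fst z) / 2" "D (fst z) (snd z)"
          "a (snd z) / 2" "D (snd z) (fst z)"] assms(4) D_nonneg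
      by (simp only: fst_swap snd_swap) simp
  qed
  also have "\<dots> = (\<integral>\<^sup>+z. ?F z \<partial>count_space UNIV) + (\<integral>\<^sup>+z. ?F (prod.swap z) \<partial>count_space UNIV)"
    by (rule nn_integral_add) auto
  also have "\<dots> = 2 * (\<integral>\<^sup>+z. ?F z \<partial>count_space UNIV)"
    unfolding nn_integral_count_space_swap[of ?F] by (simp add: mult_2)
  also have "\<dots> = 2 * (\<integral>\<^sup>+x. ennreal (a x / 2) * (\<integral>\<^sup>+y. ennreal (D x y) \<partial>count_space UNIV)
      \<partial>count_space UNIV)"
    using nn_integral_count_space_pair[of "\<lambda>x y. ennreal (a x / 2) * ennreal (D x y)"]
    by (simp add: nn_integral_cmult)
  also have "\<dots> = (\<integral>\<^sup>+x. 2 * (ennreal (a x / 2) * (\<integral>\<^sup>+y. ennreal (D x y) \<partial>count_space UNIV))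
      \<partial>count_space UNIV)"
    by (subst nn_integral_cmult) auto
  also have "\<dots> \<le> (\<integral>\<^sup>+x. 2 * (ennreal (a x / 2) * ennreal (m x)) \<partial>count_space UNIV)"
    using assms(1)
    by (intro nn_integral_mono mult_left_mono)
      (auto simp: admissible_def D_def infsum_ennreal_eq_nn_integral)
  also have "\<dots> = (\<integral>\<^sup>+x. ennreal (a x * m x) \<partial>count_space UNIV)"
  proof (intro nn_integral_cong)
    fix x
    have "2 * ennreal (a x / 2) = ennreal (2 * (a x / 2))"
      by (subst ennreal_mult') auto
    then show "2 * (ennreal (a x / 2) * ennreal (m x)) = ennreal (a x * m x)"
      using assms(4) by (simp add: ennreal_mult' flip: mult.assoc)
  qed
  finally show ?thesis .
qed

text \<open>\<open>N\<close> is the p-th power of the norm and \<open>S\<close> twice the energy of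
  \<phi>; \<open>s\<close> stays free so that it can be adapted to the isoperimetric bound.\<close>

lemma (in weighted_graph) isoperimetric_energy_bound:
  fixes p s :: real
  assumes p: "1 < p" and s: "0 < s"
    and d: "d \<in> admissible b m p" and H: "H \<le> isoperimetric b m d"
    and fin: "finite {x. \<phi> x \<noteq> 0}"
  defines "N \<equiv> \<integral>\<^sup>+x. ennreal (\<bar>\<phi> x\<bar> powr p * m x) \<partial>count_space UNIV"
    and "S \<equiv> \<integral>\<^sup>+z. ennreal (b (fst z) (snd z) * \<bar>\<phi> (fst z) - \<phi> (snd z)\<bar> powr p)
               \<partial>count_space UNIV"
  shows "2 * (H * N) \<le> ennreal (s powr (1 - p)) * S + ennreal ((p - 1) * s) * N"
proof -
  define g where "g x = \<bar>\<phi> x\<bar> powr p" for x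
  have d_nonneg: "0 \<le> d x y" and d_sym: "d x y = d y x" for x y
    using d by (auto simp: admissible_def)
  let ?w = "\<lambda>z. ennreal (b (fst z) (snd z) * d (fst z) (snd z))"
  let ?F = "\<lambda>z. ?w z * ennreal (g (fst z) - g (snd z))"
  let ?M = "\<lambda>z. b (fst z) (snd z) * (d (fst z) (snd z) powr (p / (p - 1))
              * ((g (fst z) + g (snd z)) / 2))"
  let ?E = "\<lambda>z. b (fst z) (snd z) * \<bar>\<phi> (fst z) - \<phi> (snd z)\<bar> powr p"
  have coarea: "H * N \<le> (\<integral>\<^sup>+z. ?F z \<partial>count_space UNIV)"
  proof -
    have "N = (\<integral>\<^sup>+x. ennreal (m x) * ennreal (g x) \<partial>count_space UNIV)"
      unfolding N_def g_def using m_pos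
      by (intro nn_integral_cong) (simp add: ennreal_mult' mult.commute less_imp_le)
    then show ?thesis
      using isoperimetric_coarea[of H m b d g] isoperimetric_le_boundary_area[OF H] fin
      by (simp add: g_def)
  qed
  \<comment> \<open>Adding the two orientations turns the positive parts into |g x - g y|; this is
    the source of the factor 2 on the left.\<close>
  have pointwise: "?F z + ?F (prod.swap z)
      \<le> ennreal (s powr (1 - p)) * ennreal (?E z) + ennreal ((p - 1) * s) * ennreal (?M z)" for z
  proof -
    obtain x y where z: "z = (x, y)" by force
    have b0: "0 \<le> b x y" by (rule b_nonneg)
    have "ennreal (g x - g y) + ennreal (g y - g x) = ennreal \<bar>g x - g y\<bar>"
      by (cases "g x \<le> g y") (auto simp: ennreal_neg)
    then have "?F z + ?F (prod.swap z) = ennreal (b x y * d x y) * ennreal \<bar>g x - g y\<bar>"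
      using b_sym[of y x] d_sym[of y x] by (simp add: z flip: distrib_left)
    also have "\<dots> = ennreal (b x y * (d x y * \<bar>g x - g y\<bar>))"
      using b0 d_nonneg by (simp add: mult.assoc flip: ennreal_mult)
    also have "\<dots> \<le> ennreal (b x y * (s powr (1 - p) * \<bar>\<phi> x - \<phi> y\<bar> powr p
        + (p - 1) * s * (d x y powr (p / (p - 1)) * ((g x + g y) / 2))))"
      using weighted_powr_diff_le[OF p d_nonneg s] b0
      by (intro ennreal_leI mult_left_mono) (simp_all add: g_def)
    also have "\<dots> = ennreal (s powr (1 - p) * ?E z + (p - 1) * s * ?M z)"
      by (simp add: z algebra_simps)
    also have "\<dots> = ennreal (s powr (1 - p)) * ennreal (?E z)
        + ennreal ((p - 1) * s) * ennreal (?M z)"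
      using b0 p s by (intro ennreal_add_mult) (auto simp: z g_def)
    finally show ?thesis .
  qed
  have "2 * (H * N) \<le> 2 * (\<integral>\<^sup>+z. ?F z \<partial>count_space UNIV)"
    using coarea by (rule mult_left_mono) simp
  also have "\<dots> = (\<integral>\<^sup>+z. ?F z \<partial>count_space UNIV) + (\<integral>\<^sup>+z. ?F (prod.swap z) \<partial>count_space UNIV)"
    unfolding nn_integral_count_space_swap[of ?F] by (simp add: mult_2)
  also have "\<dots> = (\<integral>\<^sup>+z. ?F z + ?F (prod.swap z) \<partial>count_space UNIV)"
    by (rule nn_integral_add[symmetric]) auto
  also have "\<dots> \<le> (\<integral>\<^sup>+z. ennreal (s powr (1 - p)) * ennreal (?E z)
      + ennreal ((p - 1) * s) * ennreal (?M z) \<partial>count_space UNIV)"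
    by (intro nn_integral_mono pointwise)
  also have "\<dots> = ennreal (s powr (1 - p)) * S
      + ennreal ((p - 1) * s) * (\<integral>\<^sup>+z. ennreal (?M z) \<partial>count_space UNIV)"
    unfolding S_def by (subst nn_integral_add) (auto simp: nn_integral_cmult)
  also have "\<dots> \<le> ennreal (s powr (1 - p)) * S + ennreal ((p - 1) * s) * N"
    unfolding N_def g_def
    using admissible_weighted_sum_le[OF d b_nonneg b_sym, of "\<lambda>x. \<bar>\<phi> x\<bar> powr p"]
    by (intro add_left_mono mult_left_mono) auto
  finally show ?thesis .
qed

section \<open>Supremum over weights and choice of the parameter\<close>

text \<open>Reduces a bound on a supremum in [0,\<infinity>] to real positive \<open>h\<close> below
  a single \<open>f d\<close>.\<close>

lemma epowr_SUP_le:
  fixes K p :: real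
  assumes "0 < p" "0 \<le> K"
    and bound: "\<And>d h. d \<in> D \<Longrightarrow> 0 < h \<Longrightarrow> ennreal h \<le> f d \<Longrightarrow> h powr p \<le> K"
  shows "epowr (SUP d\<in>D. f d) p \<le> ennreal K"
proof -
  define k where "k = K powr (1 / p)"
  have k: "0 \<le> k" "k powr p = K"
    using assms by (simp_all add: k_def powr_powr)
  have "(SUP d\<in>D. f d) \<le> ennreal k"
  proof (rule SUP_least, rule ccontr)
    fix d assume d: "d \<in> D" and "\<not> f d \<le> ennreal k"
    \<comment> \<open>Density gives a finite level above \<open>k\<close> even when
      \<open>f d\<close> is infinite, so the contradiction also rules out an infinite
      supremum.\<close>
    then obtain y where y: "ennreal k < y" "y < f d"
      by (meson dense not_le)
    then obtain h where h: "y = ennreal h" "0 \<le> h"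
      by (cases y) auto
    then have "k < h" using y k by (simp add: ennreal_less_iff)
    then have "k powr p < h powr p"
      using k assms by (intro powr_less_mono2) auto
    moreover have "h powr p \<le> K"
      using bound[OF d, of h] y h k \<open>k < h\<close> by simp
    ultimately show False using k by simp
  qed
  then obtain r where r: "(SUP d\<in>D. f d) = ennreal r" "0 \<le> r" "r \<le> k"
    using k by (cases "SUP d\<in>D. f d") (auto simp: top_unique)
  then have "r powr p \<le> k powr p"
    using assms by (intro powr_mono2) auto
  then show ?thesis using r k by (simp add: epowr_def ennreal_leI)
qed

theorem theorem3p1:
  fixes b :: "'a::countable \<Rightarrow> 'a \<Rightarrow> real" and m :: "'a \<Rightarrow> real" and p :: real
  assumes "weighted_graph b m" and "1 < p"
  shows "ennreal (2 powr (p - 1) / p powr p) * epowr (isoperimetric_const b m p) p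
           \<le> lambda0 b m p"
  unfolding lambda0_def
proof (rule INF_greatest)
  interpret weighted_graph b m by (rule assms)
  fix \<phi> :: "'a \<Rightarrow> real" assume "\<phi> \<in> finitely_supported - {\<lambda>_. 0}"
  then have fin: "finite {x. \<phi> x \<noteq> 0}" and "\<phi> \<noteq> (\<lambda>_. 0)"
    by (auto simp: finitely_supported_def)
  then obtain x0 where x0: "\<phi> x0 \<noteq> 0" by auto
  define n where "n = (\<Sum>x | \<phi> x \<noteq> 0. \<bar>\<phi> x\<bar> powr p * m x)"
  define S where "S = (\<integral>\<^sup>+z. ennreal (b (fst z) (snd z) * \<bar>\<phi> (fst z) - \<phi> (snd z)\<bar> powr p)
               \<partial>count_space UNIV)"
  have n: "0 < n"
    unfolding n_def using fin x0 m_pos by (intro sum_pos) auto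
  have N: "(\<integral>\<^sup>+x. ennreal (\<bar>\<phi> x\<bar> powr p * m x) \<partial>count_space UNIV) = ennreal n"
    unfolding n_def using fin m_pos
    by (subst nn_integral_count_space'[where A = "{x. \<phi> x \<noteq> 0}"]) (auto simp: less_imp_le)
  have norm: "epowr (pnorm m p \<phi>) p = ennreal n"
    using n assms(2)
    by (simp add: pnorm_def infsum_ennreal_eq_nn_integral N epowr_def powr_powr)
  have energy: "energy b p \<phi> = ennreal (1 / 2) * S"
    by (simp add: energy_def S_def infsum_ennreal_eq_nn_integral case_prod_beta)
  show "ennreal (2 powr (p - 1) / p powr p) * epowr (isoperimetric_const b m p) p
      \<le> energy b p \<phi> / epowr (pnorm m p \<phi>) p"
  proof (cases S)
    case top
    then show ?thesis
      unfolding norm energy by (simp add: ennreal_mult_top ennreal_top_divide)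
  next
    case (real \<sigma>)
    define c where "c = 2 powr (p - 1) / p powr p"
    have c: "0 < c" using assms(2) by (simp add: c_def)
    \<comment> \<open>The right-hand side is the quotient (\<sigma> / 2) / n of energy and norm,
      divided by \<open>c\<close>.\<close>
    have "epowr (isoperimetric_const b m p) p \<le> ennreal (\<sigma> / (2 * n * c))"
      unfolding isoperimetric_const_def
    proof (rule epowr_SUP_le)
      fix d h assume d: "d \<in> admissible b m p" and h: "0 < h" "ennreal h \<le> isoperimetric b m d"
      \<comment> \<open>This value of \<open>s\<close> maximises \<open>s powr (p - 1) * (2 * h - (p - 1) * s)\<close>.\<close>
      define s where "s = 2 * h / p"
      have s: "0 < s" using h assms(2) by (simp add: s_def)
      have "2 * (ennreal h * ennreal n)
          \<le> ennreal (s powr (1 - p)) * ennreal \<sigma> + ennreal ((p - 1) * s) * ennreal n"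
        using isoperimetric_energy_bound[OF assms(2) s d h(2) fin] real
        unfolding N S_def by simp
      moreover have "2 * (ennreal h * ennreal n) = ennreal (2 * (h * n))"
        using h n by (simp add: ennreal_mult)
      moreover have "ennreal (s powr (1 - p)) * ennreal \<sigma> + ennreal ((p - 1) * s) * ennreal n
          = ennreal (s powr (1 - p) * \<sigma> + (p - 1) * s * n)"
        using s n assms(2) real by (intro ennreal_add_mult[symmetric]) auto
      ultimately have "2 * (h * n) \<le> s powr (1 - p) * \<sigma> + (p - 1) * s * n"
        using s n assms(2) real by (simp del: ennreal_plus)
      \<comment> \<open>Hence 2 h n - (p-1) s n is exactly s n.\<close>
      moreover have "2 * h = p * s" using assms(2) by (simp add: s_def)
      ultimately have "s * n \<le> s powr (1 - p) * \<sigma>"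
        by (simp add: left_diff_distrib flip: mult.assoc)
      then have "s powr (p - 1) * (s * n) \<le> s powr (p - 1) * (s powr (1 - p) * \<sigma>)"
        by (rule mult_left_mono) simp
      also have "\<dots> = \<sigma>"
        using s by (simp flip: mult.assoc powr_add)
      also have "s powr (p - 1) * (s * n) = s powr p * n"
        using s powr_mult_base[of s "p - 1"] by (simp add: mult.commute mult.left_commute)
      \<comment> \<open>The constant of the theorem arises here: s^p = (2/p)^p h^p, and (2/p)^p = 2
        c.\<close>
      also have "s powr p = 2 * c * h powr p"
        using h assms(2) by (simp add: s_def c_def powr_divide powr_mult powr_diff)
      finally show "h powr p \<le> \<sigma> / (2 * n * c)"
        using n c by (simp add: field_simps)
    qed (use assms real n c in auto)
    then have "ennreal c * epowr (isoperimetric_const b m p) p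
        \<le> ennreal c * ennreal (\<sigma> / (2 * n * c))"
      by (rule mult_left_mono) simp
    also have "\<dots> = ennreal (1 / 2 * \<sigma> / n)"
      using c n real by (subst ennreal_mult[symmetric]) auto
    also have "\<dots> = energy b p \<phi> / epowr (pnorm m p \<phi>) p"
      unfolding norm energy using real n
      by (simp add: ennreal_mult[symmetric] divide_ennreal del: ennreal_half)
    finally show ?thesis by (simp add: c_def)
  qed
qed

end
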